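(* Let $T$ be a second-countable locally compact topological space, and let $(\mu_t)_{t\in T}$ and $(\mu^{(n)}_t)_{t\in T}$, $n\in\mathbb{N}$, be elements of $C(T;\mathbf{M}(\mathbb{R}^d))$. Then the following are equivalent as $n\to\infty$: (i) $\mu^{(n)}_t\xrightarrow{\rm l.u.w.}\mu_t$ on $T$; (ii) $\widehat{\mu^{(n)}_t}(\xi)\to\widehat{\mu_t}(\xi)$ locally uniformly on $\mathbb{R}^d\times T$ (i.e. uniformly on every compact subset of $\mathbb{R}^d\times T$); (iii) for each $\xi\in\mathbb{R}^d$, $\widehat{\mu^{(n)}_t}(\xi)\to\widehat{\mu_t}(\xi)$ locally uniformly on $T$ (i.e. uniformly in $t$ on every compact $K\subset T$).
   Context: $\mathbf{M}(\mathbb{R}^d)$ is the set of finite Borel measures on $\mathbb{R}^d$ with the weak topology, and $C(T;\mathbf{M}(\mathbb{R}^d))$ is the set of weakly continuous maps $T\to\mathbf{M}(\mathbb{R}^d)$. $\hat\mu(\xi)=\int e^{i\xi\cdot x}\,\mu(dx)$. For families $(\mu^{(n)}_t)_{t\in T}$, $(\mu_t)_{t\in T}$ of finite Borel measures on a metric space $S$, we write $\mu^{(n)}_t\xrightarrow{\rm l.u.w.}\mu_t$ (locally uniform weak convergence on $T$) if $\lim_{n\to\infty}\sup_{t\in K}|\int_S f\,d\mu^{(n)}_t-\int_S f\,d\mu_t|=0$ for every compact $K\subset T$ and every bounded continuous $f:S\to\mathbb{C}$. *)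

theory Defs
  imports "HOL-Analysis.Analysis"
begin

definition finite_borel_measure :: "'b::euclidean_space measure \<Rightarrow> bool" where
  "finite_borel_measure M \<longleftrightarrow> sets M = sets borel \<and> finite_measure M"

definition bdd_cont :: "('b::euclidean_space \<Rightarrow> complex) \<Rightarrow> bool" where
  "bdd_cont f \<longleftrightarrow> continuous_on UNIV f \<and> bounded (range f)"

text \<open>Elements of C(T; M(R^d)): families of finite Borel measures, weakly continuous in t
  (weak topology = initial topology of the maps mu |-> integral of f, f bounded continuous).\<close>
definition weakly_continuous_family ::
    "'a topology \<Rightarrow> ('a \<Rightarrow> 'b::euclidean_space measure) \<Rightarrow> bool" where
  "weakly_continuous_family X mu \<longleftrightarrow>
     (\<forall>t\<in>topspace X. finite_borel_measure (mu t)) \<and>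
     (\<forall>f. bdd_cont f \<longrightarrow> continuous_map X euclidean (\<lambda>t. integral\<^sup>L (mu t) f))"

definition ftrans :: "'b::euclidean_space measure \<Rightarrow> 'b \<Rightarrow> complex" where
  "ftrans M \<xi> = integral\<^sup>L M (\<lambda>x. cis (\<xi> \<bullet> x))"

definition luw_conv ::
    "'a topology \<Rightarrow> (nat \<Rightarrow> 'a \<Rightarrow> 'b::euclidean_space measure) \<Rightarrow> ('a \<Rightarrow> 'b measure) \<Rightarrow> bool" where
  "luw_conv X mun mu \<longleftrightarrow>
     (\<forall>K f. compactin X K \<and> bdd_cont f \<longrightarrow>
        (\<forall>e>0. \<forall>\<^sub>F n in sequentially. \<forall>t\<in>K.
           norm (integral\<^sup>L (mun n t) f - integral\<^sup>L (mu t) f) < e))"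

end

(*
  Failure of uniform convergence on a compact K produces a subsequence r and points t_n in K, so
  every implication reduces to sequences: kappa_n = mu(t_n) and nu_n = mun (r n) (t_n) with
  ftrans nu_n - ftrans kappa_n tending to 0 pointwise.  The kappa_n are tight by Dini's argument on
  K.  Averaging the transform along the coordinate axes against a normal law gives the integral of
  a Gaussian, which by dominated convergence carries tightness from kappa_n over to nu_n.  On a
  large ball a bounded continuous f is approximated by a trigonometric polynomial that stays bounded
  on the whole space (Stone-Weierstrass on a cube, pulled back along x |-> sin(theta x_b)), and
  tightness controls the rest.  Tightness also makes the transforms equicontinuous, which yields
  uniformity in the frequency.
*)
theory Submission
  (* Defs comes last: HOL-Probability has another constant finite_borel_measure. *)
  imports "HOL-Probability.Characteristic_Functions" Defs
begin

section \<open>Finite Borel measures and their Fourier transforms\<close>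

lemma finite_borel_measureD:
  assumes "finite_borel_measure M"
  shows "sets M = sets borel" "space M = UNIV" "finite_measure M"
  using assms sets_eq_imp_space_eq[of M borel] by (auto simp: finite_borel_measure_def)

lemma integrable_bounded_continuous:
  fixes f :: "'b::euclidean_space \<Rightarrow> 'c::{banach, second_countable_topology}"
  assumes M: "finite_borel_measure M" and f: "continuous_on UNIV f" and B: "\<And>x. norm (f x) \<le> B"
  shows "integrable M f"
proof -
  interpret finite_measure M by (rule finite_borel_measureD(3)[OF M])
  have "f \<in> borel_measurable M"
    using borel_measurable_continuous_onI[OF f] measurable_cong_sets[OF finite_borel_measureD(1)[OF M] refl]
    by blast
  then show ?thesis
    by (intro integrable_const_bound[where B = B]) (auto simp: B)
qed

lemma integrable_cis_inner:
  assumes "finite_borel_measure M"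
  shows "integrable M (\<lambda>x. cis (\<xi> \<bullet> x))"
  by (rule integrable_bounded_continuous[OF assms, where B = 1])
     (auto intro!: continuous_on_cis continuous_intros)

lemma ftrans_0:
  assumes "finite_borel_measure M"
  shows "ftrans M 0 = of_real (measure M UNIV)"
  using finite_borel_measureD[OF assms] by (simp add: ftrans_def scaleR_conv_of_real)

lemma norm_ftrans_le:
  assumes "finite_borel_measure M"
  shows "norm (ftrans M \<xi>) \<le> measure M UNIV"
proof -
  have "norm (ftrans M \<xi>) \<le> (LINT x|M. norm (cis (\<xi> \<bullet> x)))"
    unfolding ftrans_def by (rule integral_norm_bound)
  then show ?thesis
    using finite_borel_measureD[OF assms] by simp
qed

text \<open>Splits the integral at radius \<open>R\<close>: the integrand is dominated by
  \<open>a\<close> plus \<open>b\<close> times the indicator of the tail. Every later estimate that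
  exploits tightness goes through this bound, with \<open>a\<close> and the tail mass small while
  \<open>b\<close> stays fixed.\<close>

lemma norm_integral_le_tail:
  fixes f :: "'b::euclidean_space \<Rightarrow> 'c::{banach, second_countable_topology}"
  assumes M: "finite_borel_measure M" and f: "continuous_on UNIV f"
    and a: "0 \<le> a" "\<And>x. norm x \<le> R \<Longrightarrow> norm (f x) \<le> a" and b: "\<And>x. norm (f x) \<le> b"
  shows "norm (integral\<^sup>L M f) \<le> a * measure M UNIV + b * measure M {x. R < norm x}"
proof -
  interpret finite_measure M by (rule finite_borel_measureD(3)[OF M])
  have [measurable_cong]: "sets M = sets borel" and sp: "space M = UNIV"
    using finite_borel_measureD[OF M] by auto
  have int: "integrable M (\<lambda>x. a + b * indicator {x. R < norm x} x)"
    by (intro integrable_const_bound[where B = "a + \<bar>b\<bar>"] AE_I2) (use a in \<open>auto simp: indicator_def\<close>)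
  have b0: "0 \<le> b" using order_trans[OF norm_ge_zero b] .
  have "norm (integral\<^sup>L M f) \<le> (LINT x|M. a + b * indicator {x. R < norm x} x)"
    by (intro Bochner_Integration.integral_norm_bound_integral integrable_bounded_continuous[OF M f b] int)
       (use a b b0 in \<open>auto simp: indicator_def not_less add_increasing\<close>)
  also have "\<dots> = a * measure M UNIV + b * measure M {x. R < norm x}"
  proof -
    have "integrable M (\<lambda>x. b * indicator {x. R < norm x} x)"
      by (intro integrable_const_bound[where B = "\<bar>b\<bar>"]) (auto simp: indicator_def)
    then show ?thesis using sp by simp
  qed
  finally show ?thesis .
qed

text \<open>The Gaussian in \<open>r * (b \<bullet> x)\<close> is the characteristic function of the
  standard normal law at that point, so Fubini turns its integral over \<open>M\<close> into an
  average of the transform along the line spanned by \<open>b\<close>.\<close>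

lemma gaussian_integral_eq_ftrans:
  fixes b :: "'b::euclidean_space"
  assumes M: "finite_borel_measure M"
  shows "complex_of_real (LINT x|M. exp (- (r * (b \<bullet> x))\<^sup>2 / 2)) =
    (LINT s|std_normal_distribution. ftrans M ((r * s) *\<^sub>R b))"
proof -
  let ?N = "std_normal_distribution"
  interpret N: real_distribution ?N by (rule real_dist_normal_dist)
  interpret M: finite_measure M by (rule finite_borel_measureD(3)[OF M])
  have sM: "sets M = sets borel" by (rule finite_borel_measureD(1)[OF M])
  interpret P: pair_sigma_finite ?N M ..
  interpret F: finite_measure "?N \<Otimes>\<^sub>M M"
    by (intro finite_measure_pair_measure) unfold_locales
  \<comment> \<open>Joint measurability comes from continuity, once the product sigma-algebra is
    identified with the Borel sets of the product space. Integrability then follows because both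
    measures are finite and characters have modulus 1.\<close>
  have "(\<lambda>p::real \<times> 'b. cis (((r * fst p) *\<^sub>R b) \<bullet> snd p)) \<in> borel_measurable borel"
    by (intro borel_measurable_continuous_onI continuous_on_cis continuous_intros)
  moreover have "sets (?N \<Otimes>\<^sub>M M) = sets (borel :: (real \<times> 'b) measure)"
    unfolding borel_prod[symmetric] by (intro sets_pair_measure_cong) (auto simp: sM)
  ultimately have meas: "(\<lambda>p. cis (((r * fst p) *\<^sub>R b) \<bullet> snd p)) \<in> borel_measurable (?N \<Otimes>\<^sub>M M)"
    using measurable_cong_sets by blast
  have "complex_of_real (LINT x|M. exp (- (r * (b \<bullet> x))\<^sup>2 / 2))
      = (LINT x|M. char ?N (r * (b \<bullet> x)))"
    by (simp add: char_std_normal_distribution)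
  also have "\<dots> = (LINT x|M. LINT s|?N. cis (((r * s) *\<^sub>R b) \<bullet> x))"
    by (simp add: char_def cis_conv_exp algebra_simps)
  also have "\<dots> = (LINT s|?N. LINT x|M. cis (((r * s) *\<^sub>R b) \<bullet> x))"
    using F.integrable_const_bound[where B = 1, OF _ meas]
    by (intro P.Fubini_integral) (auto simp: split_beta')
  finally show ?thesis by (simp add: ftrans_def)
qed

section \<open>Tight sequences of measures\<close>

text \<open>The tail condition is asked only for large \<open>n\<close>, which is the form a limit
  argument delivers. A single finite measure on a Euclidean space is tight, so this amounts to
  tightness of the whole sequence.\<close>

definition tight_sequence :: "(nat \<Rightarrow> 'b::euclidean_space measure) \<Rightarrow> bool" where
  "tight_sequence \<nu> \<longleftrightarrow> (\<forall>n. finite_borel_measure (\<nu> n)) \<and> (\<exists>m. \<forall>n. measure (\<nu> n) UNIV \<le> m) \<and>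
     (\<forall>e>0. \<exists>R. \<forall>\<^sub>F n in sequentially. measure (\<nu> n) {x. R < norm x} < e)"

lemma tight_sequence_obtain:
  assumes "tight_sequence \<nu>"
  obtains m where "0 \<le> m" "\<And>n. measure (\<nu> n) UNIV \<le> m"
  using assms unfolding tight_sequence_def by (meson measure_nonneg order_trans)

text \<open>Integrands and measures may both vary with \<open>n\<close>: on a large ball the
  integrand is uniformly small, and outside it the bound \<open>B\<close> meets a small tail
  mass.\<close>

lemma integral_tight_sequence_tendsto_0:
  fixes f :: "nat \<Rightarrow> 'b::euclidean_space \<Rightarrow> 'c::{banach, second_countable_topology}"
  assumes \<nu>: "tight_sequence \<nu>" and cont: "\<And>n. continuous_on UNIV (f n)"
    and B: "\<And>n x. norm (f n x) \<le> B"
    and unif: "\<And>R e. 0 < e \<Longrightarrow> \<forall>\<^sub>F n in sequentially. \<forall>x. norm x \<le> R \<longrightarrow> norm (f n x) \<le> e"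
  shows "(\<lambda>n. integral\<^sup>L (\<nu> n) (f n)) \<longlonglongrightarrow> 0"
proof (rule tendstoI)
  fix e :: real assume e: "0 < e"
  obtain m where m: "0 \<le> m" "\<And>n. measure (\<nu> n) UNIV \<le> m"
    using tight_sequence_obtain[OF \<nu>] by blast
  have B0: "0 \<le> B" using order_trans[OF norm_ge_zero B] .
  \<comment> \<open>The ball costs at most \<open>d * m\<close> and the tail at most
    \<open>B * d\<close>; the summand 1 keeps the denominator positive and the total strictly below
    \<open>e\<close>.\<close>
  define d where "d = e / (m + B + 1)"
  have d: "0 < d" using e m B0 by (simp add: d_def)
  have de: "d * m + B * d < e"
  proof -
    have "e = d * (m + B + 1)" using m B0 by (simp add: d_def)
    then show ?thesis using d by (simp add: algebra_simps)
  qed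
  obtain R where R: "\<forall>\<^sub>F n in sequentially. measure (\<nu> n) {x. R < norm x} < d"
    using \<nu> d unfolding tight_sequence_def by blast
  show "\<forall>\<^sub>F n in sequentially. dist (integral\<^sup>L (\<nu> n) (f n)) 0 < e"
    using R unif[OF d, of R]
  proof eventually_elim
    case (elim n)
    have fb: "finite_borel_measure (\<nu> n)" using \<nu> by (simp add: tight_sequence_def)
    have "norm (integral\<^sup>L (\<nu> n) (f n)) \<le> d * measure (\<nu> n) UNIV + B * measure (\<nu> n) {x. R < norm x}"
      using d elim(2) by (intro norm_integral_le_tail[OF fb cont _ _ B]) auto
    also have "\<dots> \<le> d * m + B * d"
      using d m B0 elim by (intro add_mono mult_left_mono) auto
    finally show ?case using de by simp
  qed
qed


section \<open>Transfer of tightness by Gaussian averages\<close>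

text \<open>Dominated convergence with majorant 1. Continuity is what makes the transform measurable
  in the frequency, so that it can be averaged.\<close>

lemma continuous_on_ftrans:
  assumes M: "finite_borel_measure M"
  shows "continuous_on UNIV (ftrans M)"
  unfolding continuous_on_sequentially
proof (intro allI ballI impI)
  fix X and \<xi> :: 'a assume "(\<forall>n. X n \<in> UNIV) \<and> X \<longlonglongrightarrow> \<xi>"
  then have X: "X \<longlonglongrightarrow> \<xi>" by blast
  interpret finite_measure M by (rule finite_borel_measureD(3)[OF M])
  have lim: "(\<lambda>n. cis (X n \<bullet> x)) \<longlonglongrightarrow> cis (\<xi> \<bullet> x)" for x
    unfolding cis_conv_exp by (intro tendsto_intros X)
  show "(ftrans M \<circ> X) \<longlonglongrightarrow> ftrans M \<xi>"
    unfolding ftrans_def comp_def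
    by (rule integral_dominated_convergence[where w = "\<lambda>_. 1"])
       (auto intro: borel_measurable_integrable integrable_cis_inner M lim)
qed

text \<open>Both Gaussian integrals are averages of transforms against the same normal law, so
  pointwise convergence of the transforms passes to them by dominated convergence; the common mass
  bound provides the majorant \<open>m + m\<close>.\<close>

lemma gaussian_integral_diff_tendsto_0:
  fixes b :: "'b::euclidean_space"
  assumes \<nu>: "\<And>n. finite_borel_measure (\<nu> n)" and \<kappa>: "\<And>n. finite_borel_measure (\<kappa> n)"
    and m: "\<And>n. measure (\<nu> n) UNIV \<le> m" "\<And>n. measure (\<kappa> n) UNIV \<le> m"
    and conv: "\<And>\<xi>. (\<lambda>n. ftrans (\<nu> n) \<xi> - ftrans (\<kappa> n) \<xi>) \<longlonglongrightarrow> 0"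
  shows "(\<lambda>n. (LINT x|\<nu> n. exp (- (r * (b \<bullet> x))\<^sup>2 / 2)) - (LINT x|\<kappa> n. exp (- (r * (b \<bullet> x))\<^sup>2 / 2)))
    \<longlonglongrightarrow> 0" (is "(\<lambda>n. ?d n) \<longlonglongrightarrow> 0")
proof -
  let ?N = "std_normal_distribution"
  interpret N: real_distribution ?N by (rule real_dist_normal_dist)
  have meas: "(\<lambda>s. ftrans M ((r * s) *\<^sub>R b)) \<in> borel_measurable ?N"
    if "finite_borel_measure M" for M
  proof -
    have "(\<lambda>s. ftrans M ((r * s) *\<^sub>R b)) \<in> borel_measurable borel"
      by (intro borel_measurable_continuous_onI continuous_on_compose2[OF continuous_on_ftrans[OF that]]
          continuous_intros) auto
    then show ?thesis by simp
  qed
  have int: "integrable ?N (\<lambda>s. ftrans M ((r * s) *\<^sub>R b))" if "finite_borel_measure M" for M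
    using norm_ftrans_le[OF that] meas[OF that]
    by (intro N.integrable_const_bound[where B = "measure M UNIV"]) auto
  have "(\<lambda>n. LINT s|?N. ftrans (\<nu> n) ((r * s) *\<^sub>R b) - ftrans (\<kappa> n) ((r * s) *\<^sub>R b)) \<longlonglongrightarrow> (LINT s|?N. 0)"
  proof (rule integral_dominated_convergence[where w = "\<lambda>_. m + m"])
    show "AE s in ?N. norm (ftrans (\<nu> n) ((r * s) *\<^sub>R b) - ftrans (\<kappa> n) ((r * s) *\<^sub>R b)) \<le> m + m" for n
      by (intro AE_I2 order_trans[OF norm_triangle_ineq4] add_mono
          order_trans[OF norm_ftrans_le m(1)] order_trans[OF norm_ftrans_le m(2)] \<nu> \<kappa>)
  qed (use conv \<nu> \<kappa> meas in auto)
  moreover have "(LINT s|?N. ftrans (\<nu> n) ((r * s) *\<^sub>R b) - ftrans (\<kappa> n) ((r * s) *\<^sub>R b)) = of_real (?d n)" for n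
    using int[OF \<nu>[of n]] int[OF \<kappa>[of n]]
    unfolding of_real_diff gaussian_integral_eq_ftrans[OF \<nu>] gaussian_integral_eq_ftrans[OF \<kappa>]
    by (rule Bochner_Integration.integral_diff)
  ultimately have "(\<lambda>n. complex_of_real (?d n)) \<longlonglongrightarrow> of_real 0" by simp
  then show ?thesis by (subst (asm) tendsto_of_real_iff)
qed

lemma finite_borel_measure_tight_sequence:
  "tight_sequence \<nu> \<Longrightarrow> finite_borel_measure (\<nu> n)"
  by (simp add: tight_sequence_def)

text \<open>Since the Euclidean norm is at most the sum of the absolute coordinates, some coordinate
  exceeds \<open>1 / r\<close> in modulus. Its summand alone is at least
  \<open>1 - exp (- 1 / 2)\<close>, and the others are nonnegative.\<close>

lemma gaussian_deficit_lower_bound: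
  fixes x :: "'b::euclidean_space"
  assumes r: "0 < r" and x: "DIM('b) / r < norm x"
  shows "1 - exp (- 1 / 2) \<le> (\<Sum>b\<in>Basis. 1 - exp (- (r * (b \<bullet> x))\<^sup>2 / 2))"
proof -
  have "\<exists>b\<in>Basis. 1 / r < \<bar>b \<bullet> x\<bar>"
  proof (rule ccontr)
    assume "\<not> ?thesis"
    then have "norm x \<le> (\<Sum>b\<in>(Basis::'b set). 1 / r)"
      by (intro order_trans[OF norm_le_l1] sum_mono) (auto simp: inner_commute not_less)
    then show False using x by simp
  qed
  then obtain b where b: "b \<in> Basis" "1 / r < \<bar>b \<bullet> x\<bar>" by blast
  have "1 \<le> r * \<bar>b \<bullet> x\<bar>" using b r by (simp add: field_simps)
  then have "1 \<le> (r * \<bar>b \<bullet> x\<bar>)\<^sup>2" by (rule one_le_power)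
  then have "1 - exp (- 1 / 2) \<le> 1 - exp (- (r * (b \<bullet> x))\<^sup>2 / 2)"
    by (simp add: power_mult_distrib)
  also have "\<dots> \<le> (\<Sum>b\<in>Basis. 1 - exp (- (r * (b \<bullet> x))\<^sup>2 / 2))"
    using b(1) by (intro member_le_sum) auto
  finally show ?thesis .
qed

text \<open>The sum \<open>g r\<close> of Gaussian deficits is a substitute for the tail indicator
  whose integral is visible to the transforms: it is small on a fixed ball when \<open>r\<close> is
  small, and bounded below far out. Its integral is small under \<open>\<kappa> n\<close> by
  tightness, hence under \<open>\<nu> n\<close>, and Markov's inequality converts this into a tail
  bound.\<close>

lemma tight_sequence_transfer:
  fixes \<nu> \<kappa> :: "nat \<Rightarrow> 'b::euclidean_space measure"
  assumes \<nu>: "\<And>n. finite_borel_measure (\<nu> n)" and tight: "tight_sequence \<kappa>"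
    and conv: "\<And>\<xi>. (\<lambda>n. ftrans (\<nu> n) \<xi> - ftrans (\<kappa> n) \<xi>) \<longlonglongrightarrow> 0"
  shows "tight_sequence \<nu>"
  unfolding tight_sequence_def
proof (intro conjI allI impI \<nu>)
  note \<kappa> = finite_borel_measure_tight_sequence[OF tight]
  \<comment> \<open>At frequency 0 the transform is the total mass.\<close>
  have mass: "(\<lambda>n. measure (\<nu> n) UNIV - measure (\<kappa> n) UNIV) \<longlonglongrightarrow> 0"
    using tendsto_Re[OF conv[of 0]] by (simp add: ftrans_0[OF \<nu>] ftrans_0[OF \<kappa>])
  obtain m0 where m0: "0 \<le> m0" "\<And>n. measure (\<kappa> n) UNIV \<le> m0"
    using tight_sequence_obtain[OF tight] by blast
  \<comment> \<open>A convergent sequence is bounded, so the masses of the \<open>\<nu> n\<close>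
    are controlled for every \<open>n\<close> and not merely eventually.\<close>
  obtain k where k: "\<And>n. \<bar>measure (\<nu> n) UNIV - measure (\<kappa> n) UNIV\<bar> \<le> k"
    using Bseq_def[THEN iffD1, OF convergent_imp_Bseq[OF convergentI[OF mass]]] by auto
  define m where "m = m0 + \<bar>k\<bar>"
  have m: "measure (\<nu> n) UNIV \<le> m" "measure (\<kappa> n) UNIV \<le> m" for n
    using k[of n] m0(2)[of n] by (auto simp: m_def)
  have m_ge: "0 \<le> m" using m0 by (simp add: m_def)
  show "\<exists>m. \<forall>n. measure (\<nu> n) UNIV \<le> m" using m by blast
  fix e :: real assume e: "0 < e"
  let ?d = "real DIM('b)" and ?c = "1 - exp (- 1 / 2 :: real)"
  have d: "0 < ?d" by simp
  have c: "0 < ?c" by simp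
  define g where "g = (\<lambda>r x. \<Sum>b\<in>(Basis::'b set). 1 - exp (- (r * (b \<bullet> x))\<^sup>2 / 2))"
  have g_cont: "continuous_on UNIV (g r)" for r
    unfolding g_def by (intro continuous_intros) auto
  have g_ge: "0 \<le> g r x" for r x
    unfolding g_def by (intro sum_nonneg) auto
  have g_le: "g r x \<le> ?d" for r x
    unfolding g_def by (rule order_trans[OF sum_bounded_above[where K = 1]]) auto
  \<comment> \<open>Each deficit is quadratically small, by
    \<open>1 - exp (- u) \<le> u\<close>.\<close>
  have g_small: "g r x \<le> ?d * ((r * R)\<^sup>2 / 2)" if "norm x \<le> R" for r x R
    unfolding g_def
  proof (rule sum_bounded_above)
    fix b :: 'b assume b: "b \<in> Basis"
    have "1 - exp (- (r * (b \<bullet> x))\<^sup>2 / 2) \<le> (r * (b \<bullet> x))\<^sup>2 / 2"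
      using exp_ge_add_one_self[of "- (r * (b \<bullet> x))\<^sup>2 / 2"] by simp
    also have "\<bar>b \<bullet> x\<bar> \<le> \<bar>R\<bar>"
      using Basis_le_norm[OF b, of x] that by (simp add: inner_commute)
    then have "(r * (b \<bullet> x))\<^sup>2 / 2 \<le> (r * R)\<^sup>2 / 2"
      unfolding power_mult_distrib by (intro divide_right_mono mult_left_mono) (auto simp: abs_le_square_iff)
    finally show "1 - exp (- (r * (b \<bullet> x))\<^sup>2 / 2) \<le> (r * R)\<^sup>2 / 2" .
  qed
  have g_int: "integrable M (g r)" if "finite_borel_measure M" for r M
    using g_ge g_le by (intro integrable_bounded_continuous[OF that g_cont, where B = ?d]) auto
  have e_int: "integrable M (\<lambda>x. exp (- (r * (b \<bullet> x))\<^sup>2 / 2))" if "finite_borel_measure M" for r M and b :: 'b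
    by (intro integrable_bounded_continuous[OF that, where B = 1] continuous_intros) auto
  have g_eq: "integral\<^sup>L M (g r) = (\<Sum>b\<in>Basis. measure M UNIV - (LINT x|M. exp (- (r * (b \<bullet> x))\<^sup>2 / 2)))"
    if "finite_borel_measure M" for r M
  proof -
    interpret finite_measure M by (rule finite_borel_measureD(3)[OF that])
    show ?thesis
      unfolding g_def using e_int[OF that] finite_borel_measureD(2)[OF that]
      by (subst Bochner_Integration.integral_sum) auto
  qed
  have g_lim: "(\<lambda>n. integral\<^sup>L (\<nu> n) (g r) - integral\<^sup>L (\<kappa> n) (g r)) \<longlonglongrightarrow> 0" for r
  proof -
    have "(\<lambda>n. \<Sum>b\<in>(Basis::'b set). (measure (\<nu> n) UNIV - measure (\<kappa> n) UNIV) -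
        ((LINT x|\<nu> n. exp (- (r * (b \<bullet> x))\<^sup>2 / 2)) - (LINT x|\<kappa> n. exp (- (r * (b \<bullet> x))\<^sup>2 / 2))))
        \<longlonglongrightarrow> (\<Sum>b\<in>(Basis::'b set). 0 - 0)"
      by (intro tendsto_intros mass gaussian_integral_diff_tendsto_0[OF \<nu> \<kappa> m conv])
    then show ?thesis
      by (simp add: g_eq \<nu> \<kappa> sum_subtractf[symmetric] algebra_simps)
  qed
  \<comment> \<open>As \<open>?d\<close> bounds \<open>g r\<close>, the tail of
    \<open>\<kappa> n\<close> will contribute at most \<open>?c * e / 4\<close>. The radius
    \<open>R\<close> is fixed first; \<open>r\<close> is then chosen so small that the ball of
    radius \<open>R\<close> contributes less than the same amount. A third quarter is reserved for
    replacing \<open>\<kappa> n\<close> by \<open>\<nu> n\<close>.\<close>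
  have "0 < ?c * e / (4 * ?d)" using c d e by simp
  then obtain R where R: "\<forall>\<^sub>F n in sequentially. measure (\<kappa> n) {x. R < norm x} < ?c * e / (4 * ?d)"
    using tight unfolding tight_sequence_def by blast
  have "((\<lambda>r. ?d * ((r * R)\<^sup>2 / 2) * m) \<longlongrightarrow> 0) (at_right 0)"
    by (auto intro!: tendsto_eq_intros)
  then have "\<forall>\<^sub>F r in at_right 0. ?d * ((r * R)\<^sup>2 / 2) * m < ?c * e / 4"
    using c e by (intro order_tendstoD(2)) auto
  then have "\<forall>\<^sub>F r in at_right 0. 0 < r \<and> ?d * ((r * R)\<^sup>2 / 2) * m < ?c * e / 4"
    using eventually_at_right_less by (rule eventually_elim2) auto
  then obtain r :: real where r: "0 < r" "?d * ((r * R)\<^sup>2 / 2) * m < ?c * e / 4"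
    using eventually_happens'[OF trivial_limit_at_right_real] by blast
  have lim: "\<forall>\<^sub>F n in sequentially. integral\<^sup>L (\<nu> n) (g r) - integral\<^sup>L (\<kappa> n) (g r) < ?c * e / 4"
    using c e by (intro order_tendstoD(2)[OF g_lim]) auto
  have "\<forall>\<^sub>F n in sequentially. measure (\<nu> n) {x. ?d / r < norm x} < e"
    using R lim
  proof eventually_elim
    case (elim n)
    interpret finite_measure "\<nu> n" by (rule finite_borel_measureD(3)[OF \<nu>])
    have sets: "sets (\<nu> n) = sets borel" and sp: "space (\<nu> n) = UNIV"
      using finite_borel_measureD[OF \<nu>] by auto
    have "norm (integral\<^sup>L (\<kappa> n) (g r)) \<le> ?d * ((r * R)\<^sup>2 / 2) * measure (\<kappa> n) UNIV + ?d * measure (\<kappa> n) {x. R < norm x}"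
      using g_ge g_le g_small by (intro norm_integral_le_tail[OF \<kappa> g_cont]) auto
    also have "\<dots> \<le> ?d * ((r * R)\<^sup>2 / 2) * m + ?d * (?c * e / (4 * ?d))"
      using elim m by (intro add_mono mult_left_mono) auto
    also have "?d * (?c * e / (4 * ?d)) = ?c * e / 4" using d by simp
    finally have "integral\<^sup>L (\<nu> n) (g r) < ?c * e / 4 + ?c * e / 4 + ?c * e / 4"
      using r(2) elim(2) by (simp only: real_norm_def)
    also have "\<dots> \<le> ?c * e" using c e by simp
    finally have 1: "integral\<^sup>L (\<nu> n) (g r) < ?c * e" .
    have "{x. ?c \<le> g r x} \<in> sets (\<nu> n)"
      unfolding sets by (intro borel_closed closed_Collect_le g_cont continuous_on_const)
    \<comment> \<open>Outside the ball of radius \<open>?d / r\<close> the deficit is at least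
      \<open>?c\<close>, so the tail lies in a superlevel set to which Markov's inequality
      applies.\<close>
    then have "measure (\<nu> n) {x. ?d / r < norm x} \<le> measure (\<nu> n) {x \<in> space (\<nu> n). ?c \<le> g r x}"
      using gaussian_deficit_lower_bound[OF r(1)] by (intro finite_measure_mono) (auto simp: sp g_def)
    also have "\<dots> \<le> integral\<^sup>L (\<nu> n) (g r) / ?c"
      using c g_ge by (intro integral_Markov_inequality_measure[OF g_int[OF \<nu>], where A = "{}"]) auto
    also have "\<dots> < e" using 1 c by (simp add: field_simps)
    finally show ?case .
  qed
  then show "\<exists>R. \<forall>\<^sub>F n in sequentially. measure (\<nu> n) {x. R < norm x} < e" by blast
qed

section \<open>Trigonometric polynomials and approximation on balls\<close>

text \<open>Frequencies are arbitrary vectors rather than lattice points, because the period has to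
  be adapted to the size of a ball.\<close>

inductive trigonometric_polynomial :: "('b::euclidean_space \<Rightarrow> complex) \<Rightarrow> bool" where
  character: "trigonometric_polynomial (\<lambda>x. cis (\<xi> \<bullet> x))"
| scale: "trigonometric_polynomial p \<Longrightarrow> trigonometric_polynomial (\<lambda>x. c * p x)"
| add: "trigonometric_polynomial p \<Longrightarrow> trigonometric_polynomial q \<Longrightarrow> trigonometric_polynomial (\<lambda>x. p x + q x)"

lemma trigonometric_polynomial_const: "trigonometric_polynomial (\<lambda>x. c)"
  using trigonometric_polynomial.scale[OF trigonometric_polynomial.character[of 0], of c] by simp

text \<open>Characters multiply by adding their frequencies. The inner induction settles a character
  times \<open>q\<close>, the outer one extends this linearly.\<close>

lemma trigonometric_polynomial_mult:
  assumes "trigonometric_polynomial p" "trigonometric_polynomial q"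
  shows "trigonometric_polynomial (\<lambda>x. p x * q x)"
  using assms(1)
proof induction
  case (character \<xi>)
  show ?case using assms(2)
  proof induction
    case (character \<eta>)
    show ?case
      using trigonometric_polynomial.character[of "\<xi> + \<eta>"] by (simp add: cis_mult inner_add_left)
  next
    case (scale p c)
    then show ?case
      using trigonometric_polynomial.scale[OF scale.IH, of c] by (simp add: algebra_simps)
  next
    case (add p q)
    then show ?case
      using trigonometric_polynomial.add[OF add.IH] by (simp add: algebra_simps)
  qed
next
  case (scale p c)
  then show ?case
    using trigonometric_polynomial.scale[OF scale.IH, of c] by (simp add: algebra_simps)
next
  case (add p q)
  then show ?case
    using trigonometric_polynomial.add[OF add.IH] by (simp add: algebra_simps)
qed

lemma trigonometric_polynomial_sum:
  assumes "finite I" "\<And>i. i \<in> I \<Longrightarrow> trigonometric_polynomial (p i)"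
  shows "trigonometric_polynomial (\<lambda>x. \<Sum>i\<in>I. p i x)"
  using assms
  by (induction I rule: finite_induct)
     (auto intro: trigonometric_polynomial_const trigonometric_polynomial.add)

lemma trigonometric_polynomial_sin:
  "trigonometric_polynomial (\<lambda>x. complex_of_real (sin (\<xi> \<bullet> x)))"
proof -
  have eq: "(\<lambda>x. complex_of_real (sin (\<xi> \<bullet> x))) =
      (\<lambda>x. (1 / (2 * \<i>)) * cis (\<xi> \<bullet> x) + (- 1 / (2 * \<i>)) * cis (- \<xi> \<bullet> x))"
    by (auto simp: complex_eq_iff)
  show ?thesis
    unfolding eq
    by (rule trigonometric_polynomial.add; rule trigonometric_polynomial.scale;
        rule trigonometric_polynomial.character)
qed

lemma trigonometric_polynomial_continuous_bounded:
  assumes "trigonometric_polynomial p"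
  shows "continuous_on UNIV p \<and> (\<exists>B. \<forall>x. norm (p x) \<le> B)"
  using assms
proof induction
  case (character \<xi>)
  show ?case by (auto intro!: continuous_on_cis continuous_intros exI[of _ 1])
next
  case (scale p c)
  then obtain B where "\<And>x. norm (p x) \<le> B" by blast
  then have "norm (c * p x) \<le> norm c * B" for x by (simp add: norm_mult mult_left_mono)
  with scale show ?case by (auto intro!: continuous_intros)
next
  case (add p q)
  then obtain B C where "\<And>x. norm (p x) \<le> B" "\<And>x. norm (q x) \<le> C" by blast
  then have "norm (p x + q x) \<le> B + C" for x by (rule norm_triangle_mono)
  with add show ?case by (auto intro!: continuous_intros)
qed

lemma integrable_trigonometric_polynomial:
  assumes "finite_borel_measure M" "trigonometric_polynomial p"
  shows "integrable M p"
  using trigonometric_polynomial_continuous_bounded[OF assms(2)] integrable_bounded_continuous[OF assms(1)]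
  by blast

text \<open>Real polynomial functions are generated from constants and linear functionals by sums
  and products, and trigonometric polynomials are closed under both, so only the linear functionals
  of \<open>s\<close> have to be checked.\<close>

lemma trigonometric_polynomial_real_polynomial:
  fixes s :: "'b::euclidean_space \<Rightarrow> 'c::real_normed_vector"
  assumes "real_polynomial_function p"
    and "\<And>h. bounded_linear h \<Longrightarrow> trigonometric_polynomial (\<lambda>x. complex_of_real (h (s x)))"
  shows "trigonometric_polynomial (\<lambda>x. complex_of_real (p (s x)))"
  using assms
  by induction
     (auto intro: trigonometric_polynomial_const trigonometric_polynomial_mult trigonometric_polynomial.add)

text \<open>The map \<open>s\<close>, a sine in each coordinate, sends the whole space into a cube
  and is inverted on the ball by arcsines. With \<open>F\<close> the function \<open>f\<close>
  transported to the cube and \<open>p\<close> a polynomial near \<open>F\<close> there,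
  \<open>p (s x)\<close> is close to \<open>f x\<close> on the ball. It is also bounded everywhere,
  since \<open>s\<close> never leaves the cube.\<close>

lemma trigonometric_approximation:
  fixes f :: "'b::euclidean_space \<Rightarrow> complex"
  assumes f: "continuous_on UNIV f" and B: "\<And>x. norm (f x) \<le> B" and e: "0 < e"
  obtains q where "trigonometric_polynomial q" "\<And>x. norm x \<le> R \<Longrightarrow> norm (f x - q x) \<le> e"
    "\<And>x. norm (q x) \<le> B + e"
proof -
  define \<rho> where "\<rho> = \<bar>R\<bar> + 1"
  have \<rho>: "0 < \<rho>" by (simp add: \<rho>_def)
  \<comment> \<open>This scale maps coordinates of modulus at most \<open>\<rho>\<close> into the
    interval from \<open>- pi / 2\<close> to \<open>pi / 2\<close>, where \<open>arcsin\<close>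
    inverts \<open>sin\<close>.\<close>
  define \<theta> where "\<theta> = pi / (2 * \<rho>)"
  have \<theta>: "0 < \<theta>" using \<rho> by (simp add: \<theta>_def)
  have \<theta>\<rho>: "\<theta> * \<rho> = pi / 2" using \<rho> by (simp add: \<theta>_def)
  define s where "s = (\<lambda>x::'b. \<Sum>b\<in>Basis. sin ((\<theta> *\<^sub>R b) \<bullet> x) *\<^sub>R b)"
  define F where "F = (\<lambda>y::'b. f (\<Sum>b\<in>Basis. (arcsin (y \<bullet> b) / \<theta>) *\<^sub>R b))"
  have s_inner: "s x \<bullet> b = sin (\<theta> * (x \<bullet> b))" if "b \<in> Basis" for x b
    using that by (simp add: s_def inner_commute[of b x])
  have s_cube: "s x \<in> cbox (- One) One" for x
    by (simp add: mem_box s_inner)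
  have F_s: "F (s x) = f x" if x: "norm x \<le> R" for x
  proof -
    have "arcsin (sin (\<theta> * (x \<bullet> b))) / \<theta> = x \<bullet> b" if "b \<in> Basis" for b
    proof -
      have "\<bar>x \<bullet> b\<bar> \<le> \<rho>" using Basis_le_norm[OF that, of x] x by (simp add: \<rho>_def)
      then have "\<theta> * \<bar>x \<bullet> b\<bar> \<le> pi / 2"
        unfolding \<theta>\<rho>[symmetric] using \<theta> by (intro mult_left_mono) auto
      then have "\<bar>\<theta> * (x \<bullet> b)\<bar> \<le> pi / 2" using \<theta> by (simp add: abs_mult)
      then show ?thesis using \<theta> by (subst arcsin_sin) auto
    qed
    then show ?thesis by (simp add: F_def s_inner euclidean_representation)
  qed
  have "continuous_on (cbox (- One) One) F"
    unfolding F_def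
    by (intro continuous_on_compose2[OF f] continuous_intros) (use \<theta> in \<open>auto simp: mem_box\<close>)
  then obtain p where p: "polynomial_function p" "\<And>y. y \<in> cbox (- One) One \<Longrightarrow> norm (F y - p y) < e"
    using Stone_Weierstrass_polynomial_function[OF compact_cbox _ e] by metis
  \<comment> \<open>By linearity \<open>h (s x)\<close> is a combination of sines of linear forms,
    which Euler's formula makes trigonometric polynomials.\<close>
  have lin: "trigonometric_polynomial (\<lambda>x. complex_of_real (h (s x)))" if "bounded_linear h" for h
  proof -
    interpret bounded_linear h by fact
    have eq: "(\<lambda>x. complex_of_real (h (s x))) =
        (\<lambda>x. \<Sum>b\<in>Basis. of_real (h b) * of_real (sin ((\<theta> *\<^sub>R b) \<bullet> x)))"
      by (simp add: s_def sum scaleR mult.commute)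
    show ?thesis
      unfolding eq
      by (intro trigonometric_polynomial_sum trigonometric_polynomial.scale trigonometric_polynomial_sin finite_Basis)
  qed
  \<comment> \<open>A vector-valued polynomial function is one whose compositions with bounded
    real-linear functionals are real polynomials; hence the real and imaginary parts are treated
    separately.\<close>
  have part: "trigonometric_polynomial (\<lambda>x. complex_of_real (h (p (s x))))" if "bounded_linear h" for h
    using p(1) that trigonometric_polynomial_real_polynomial[OF _ lin, of "h \<circ> p"]
    by (simp add: polynomial_function_def)
  have "trigonometric_polynomial (\<lambda>x. of_real (Re (p (s x))) + \<i> * of_real (Im (p (s x))))"
    by (intro trigonometric_polynomial.add trigonometric_polynomial.scale part bounded_linear_Re bounded_linear_Im)
  then have "trigonometric_polynomial (\<lambda>x. p (s x))"
    by (simp add: complex_eq[symmetric])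
  moreover have "norm (f x - p (s x)) \<le> e" if "norm x \<le> R" for x
    using p(2)[OF s_cube[of x]] F_s[OF that] by simp
  \<comment> \<open>Every value of \<open>F\<close> is a value of \<open>f\<close>, so
    \<open>B\<close> bounds \<open>F (s x)\<close> also when \<open>x\<close> lies outside the
    ball.\<close>
  moreover have "norm (p (s x)) \<le> B + e" for x
  proof -
    have "norm (p (s x)) \<le> norm (F (s x)) + norm (F (s x) - p (s x))"
      by (metis norm_triangle_sub norm_minus_commute)
    then show ?thesis using B p(2)[OF s_cube[of x]] unfolding F_def by (smt (verit))
  qed
  ultimately show thesis by (rule that)
qed

section \<open>Convergence of integrals along tight sequences\<close>

lemma trigonometric_polynomial_integral_diff_tendsto_0:
  assumes p: "trigonometric_polynomial p"
    and \<nu>: "\<And>n. finite_borel_measure (\<nu> n)" and \<kappa>: "\<And>n. finite_borel_measure (\<kappa> n)"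
    and conv: "\<And>\<xi>. (\<lambda>n. ftrans (\<nu> n) \<xi> - ftrans (\<kappa> n) \<xi>) \<longlonglongrightarrow> 0"
  shows "(\<lambda>n. integral\<^sup>L (\<nu> n) p - integral\<^sup>L (\<kappa> n) p) \<longlonglongrightarrow> 0"
  using p
proof induction
  case (character \<xi>)
  show ?case using conv[of \<xi>] by (simp add: ftrans_def)
next
  case (scale p c)
  then show ?case
    using tendsto_mult_right_zero[OF scale.IH, of c] by (simp add: right_diff_distrib)
next
  case (add p q)
  then show ?case
    using tendsto_add[OF add.IH] integrable_trigonometric_polynomial[OF \<nu>]
      integrable_trigonometric_polynomial[OF \<kappa>]
    by (simp add: algebra_simps)
qed

text \<open>Replacing \<open>f\<close> by a trigonometric polynomial costs less than
  \<open>e / 3\<close> under each of the two measures, by closeness on a ball and tightness outside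
  it; for the polynomial itself convergence follows from that of the transforms.\<close>

lemma integral_diff_tendsto_0:
  fixes f :: "'b::euclidean_space \<Rightarrow> complex"
  assumes \<nu>: "tight_sequence \<nu>" and \<kappa>: "tight_sequence \<kappa>"
    and conv: "\<And>\<xi>. (\<lambda>n. ftrans (\<nu> n) \<xi> - ftrans (\<kappa> n) \<xi>) \<longlonglongrightarrow> 0"
    and f: "continuous_on UNIV f" and B: "\<And>x. norm (f x) \<le> B"
  shows "(\<lambda>n. integral\<^sup>L (\<nu> n) f - integral\<^sup>L (\<kappa> n) f) \<longlonglongrightarrow> 0"
proof (rule tendstoI)
  fix e :: real assume e: "0 < e"
  note \<nu>_fin = finite_borel_measure_tight_sequence[OF \<nu>] and \<kappa>_fin = finite_borel_measure_tight_sequence[OF \<kappa>]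
  obtain m1 where m1: "0 \<le> m1" "\<And>n. measure (\<nu> n) UNIV \<le> m1"
    using tight_sequence_obtain[OF \<nu>] by blast
  obtain m2 where m2: "0 \<le> m2" "\<And>n. measure (\<kappa> n) UNIV \<le> m2"
    using tight_sequence_obtain[OF \<kappa>] by blast
  define m where "m = m1 + m2"
  have m: "0 \<le> m" "\<And>n. measure (\<nu> n) UNIV \<le> m" "\<And>n. measure (\<kappa> n) UNIV \<le> m"
    using m1 m2 by (auto simp: m_def add_increasing add_increasing2)
  have B0: "0 \<le> B" using order_trans[OF norm_ge_zero B] .
  \<comment> \<open>\<open>C\<close> will bound \<open>f - q\<close> globally. It must be fixed
    before \<open>d\<close> and \<open>q\<close>, which depend on it; capping \<open>d\<close> at 1
    makes \<open>B + (B + d) \<le> C\<close>.\<close>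
  define C where "C = 2 * B + 1"
  have C: "0 \<le> C" using B0 by (simp add: C_def)
  define d where "d = min 1 (e / (3 * (m + C + 1)))"
  have d: "0 < d" "d \<le> 1" using e m C by (auto simp: d_def)
  have "d * (3 * (m + C + 1)) \<le> e"
  proof -
    have "d * (3 * (m + C + 1)) \<le> e / (3 * (m + C + 1)) * (3 * (m + C + 1))"
      using m C by (intro mult_right_mono) (auto simp: d_def)
    then show ?thesis using m C by simp
  qed
  then have de: "d * m + C * d < e / 3" using d by (simp add: algebra_simps)
  obtain R1 where R1: "\<forall>\<^sub>F n in sequentially. measure (\<nu> n) {x. R1 < norm x} < d"
    using \<nu> d unfolding tight_sequence_def by blast
  obtain R2 where R2: "\<forall>\<^sub>F n in sequentially. measure (\<kappa> n) {x. R2 < norm x} < d"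
    using \<kappa> d unfolding tight_sequence_def by blast
  define R where "R = max R1 R2"
  obtain q where q: "trigonometric_polynomial q" "\<And>x. norm x \<le> R \<Longrightarrow> norm (f x - q x) \<le> d"
    "\<And>x. norm (q x) \<le> B + d"
    using trigonometric_approximation[OF f B d(1)] by blast
  have q_cont: "continuous_on UNIV q"
    using trigonometric_polynomial_continuous_bounded[OF q(1)] by blast
  \<comment> \<open>Stated for a radius \<open>R'\<close> below \<open>R\<close>, so that it serves
    both sequences, whose tails are controlled at \<open>R1\<close> and \<open>R2\<close>
    respectively.\<close>
  have bound: "norm (integral\<^sup>L M f - integral\<^sup>L M q) < e / 3"
    if M: "finite_borel_measure M" and mM: "measure M UNIV \<le> m"
      and tail: "measure M {x. R' < norm x} < d" and R': "R' \<le> R" for M R'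
  proof -
    interpret finite_measure M by (rule finite_borel_measureD(3)[OF M])
    have "integral\<^sup>L M f - integral\<^sup>L M q = (LINT x|M. f x - q x)"
      using integrable_bounded_continuous[OF M f B] integrable_trigonometric_polynomial[OF M q(1)]
      by simp
    also have "norm \<dots> \<le> d * measure M UNIV + C * measure M {x. R < norm x}"
    proof (rule norm_integral_le_tail[OF M])
      show "norm (f x - q x) \<le> C" for x
        using norm_triangle_ineq4[of "f x" "q x"] B[of x] q(3)[of x] d by (simp add: C_def)
    qed (use d q q_cont f in \<open>auto intro!: continuous_intros\<close>)
    also have "measure M {x. R < norm x} \<le> measure M {x. R' < norm x}"
      using R' finite_borel_measureD(1)[OF M] by (intro finite_measure_mono) auto
    then have "d * measure M UNIV + C * measure M {x. R < norm x} \<le> d * m + C * d"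
      using d C mM tail by (intro add_mono mult_left_mono) auto
    finally show ?thesis using de by simp
  qed
  have "\<forall>\<^sub>F n in sequentially. dist (integral\<^sup>L (\<nu> n) q - integral\<^sup>L (\<kappa> n) q) 0 < e / 3"
    using e by (intro tendstoD[OF trigonometric_polynomial_integral_diff_tendsto_0[OF q(1) \<nu>_fin \<kappa>_fin conv]]) simp
  with R1 R2 show "\<forall>\<^sub>F n in sequentially. dist (integral\<^sup>L (\<nu> n) f - integral\<^sup>L (\<kappa> n) f) 0 < e"
  proof eventually_elim
    case (elim n)
    have 3: "norm (integral\<^sup>L (\<nu> n) f - integral\<^sup>L (\<nu> n) q) < e / 3"
      by (rule bound[OF \<nu>_fin m(2) elim(1)]) (simp add: R_def)
    have 4: "norm (integral\<^sup>L (\<kappa> n) f - integral\<^sup>L (\<kappa> n) q) < e / 3"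
      by (rule bound[OF \<kappa>_fin m(3) elim(2)]) (simp add: R_def)
    have "integral\<^sup>L (\<nu> n) f - integral\<^sup>L (\<kappa> n) f =
        (integral\<^sup>L (\<nu> n) f - integral\<^sup>L (\<nu> n) q) + (integral\<^sup>L (\<nu> n) q - integral\<^sup>L (\<kappa> n) q)
        - (integral\<^sup>L (\<kappa> n) f - integral\<^sup>L (\<kappa> n) q)"
      by simp
    then have "norm (integral\<^sup>L (\<nu> n) f - integral\<^sup>L (\<kappa> n) f) \<le>
        norm (integral\<^sup>L (\<nu> n) f - integral\<^sup>L (\<nu> n) q) + norm (integral\<^sup>L (\<nu> n) q - integral\<^sup>L (\<kappa> n) q)
        + norm (integral\<^sup>L (\<kappa> n) f - integral\<^sup>L (\<kappa> n) q)"
      by (simp only:) (intro order_trans[OF norm_triangle_ineq4] add_right_mono norm_triangle_ineq)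
    then show ?case using 3 4 elim(3) by simp
  qed
qed

section \<open>Equicontinuity of the transforms of a tight sequence\<close>

text \<open>A chord of the unit circle has length \<open>2 * \<bar>sin ((a - b) / 2)\<bar>\<close>,
  which is at most the length of the arc.\<close>

lemma norm_cis_diff_le: "norm (cis a - cis b) \<le> \<bar>a - b\<bar>"
proof -
  have "cis a - cis b = cis b * (cis (a - b) - 1)"
    by (simp add: right_diff_distrib cis_mult)
  then have "norm (cis a - cis b) = 2 * \<bar>sin ((a - b) / 2)\<bar>"
    using dist_exp_i_1[of "a - b"] by (simp add: norm_mult cis_conv_exp)
  then show ?thesis using abs_sin_x_le_abs_x[of "(a - b) / 2"] by simp
qed

text \<open>Equicontinuity in sequential form: the two characters differ by at most 2 everywhere,
  and on a ball of radius \<open>R\<close> by at most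
  \<open>norm (X n - \<xi>) * \<bar>R\<bar>\<close>, which tends to 0.\<close>

lemma ftrans_tight_sequence_diff_tendsto_0:
  assumes \<nu>: "tight_sequence \<nu>" and X: "X \<longlonglongrightarrow> \<xi>"
  shows "(\<lambda>n. ftrans (\<nu> n) (X n) - ftrans (\<nu> n) \<xi>) \<longlonglongrightarrow> 0"
proof -
  note \<nu>_fin = finite_borel_measure_tight_sequence[OF \<nu>]
  have "(\<lambda>n. LINT x|\<nu> n. cis (X n \<bullet> x) - cis (\<xi> \<bullet> x)) \<longlonglongrightarrow> 0"
  proof (rule integral_tight_sequence_tendsto_0[OF \<nu>])
    show "continuous_on UNIV (\<lambda>x. cis (X n \<bullet> x) - cis (\<xi> \<bullet> x))" for n
      by (intro continuous_intros continuous_on_cis)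
    show "norm (cis (X n \<bullet> x) - cis (\<xi> \<bullet> x)) \<le> 2" for n x
      using norm_triangle_ineq4[of "cis (X n \<bullet> x)" "cis (\<xi> \<bullet> x)"] by simp
    fix R e :: real assume e: "0 < e"
    have "(\<lambda>n. norm (X n - \<xi>) * \<bar>R\<bar>) \<longlonglongrightarrow> norm (\<xi> - \<xi>) * \<bar>R\<bar>"
      by (intro tendsto_intros X)
    then have "\<forall>\<^sub>F n in sequentially. norm (X n - \<xi>) * \<bar>R\<bar> < e"
      using e by (intro order_tendstoD(2)) auto
    then show "\<forall>\<^sub>F n in sequentially. \<forall>x. norm x \<le> R \<longrightarrow> norm (cis (X n \<bullet> x) - cis (\<xi> \<bullet> x)) \<le> e"
    proof eventually_elim
      case (elim n)
      have "norm (cis (X n \<bullet> x) - cis (\<xi> \<bullet> x)) \<le> e" if "norm x \<le> R" for x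
      proof -
        have "norm (cis (X n \<bullet> x) - cis (\<xi> \<bullet> x)) \<le> \<bar>(X n - \<xi>) \<bullet> x\<bar>"
          using norm_cis_diff_le by (simp add: inner_diff_left)
        also have "\<dots> \<le> norm (X n - \<xi>) * norm x" by (rule Cauchy_Schwarz_ineq2)
        also have "\<dots> \<le> norm (X n - \<xi>) * \<bar>R\<bar>" using that by (intro mult_left_mono) auto
        finally show ?thesis using elim by simp
      qed
      then show ?case by blast
    qed
  qed
  then show ?thesis
    by (simp add: ftrans_def integrable_cis_inner[OF \<nu>_fin])
qed

text \<open>Moves from \<open>X n\<close> to the fixed frequency \<open>\<xi>\<close> under
  \<open>\<nu> n\<close>, changes the measure there, and moves back under
  \<open>\<kappa> n\<close>.\<close>

lemma ftrans_diff_tendsto_0: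
  assumes \<nu>: "tight_sequence \<nu>" and \<kappa>: "tight_sequence \<kappa>"
    and conv: "\<And>\<xi>. (\<lambda>n. ftrans (\<nu> n) \<xi> - ftrans (\<kappa> n) \<xi>) \<longlonglongrightarrow> 0" and X: "X \<longlonglongrightarrow> \<xi>"
  shows "(\<lambda>n. ftrans (\<nu> n) (X n) - ftrans (\<kappa> n) (X n)) \<longlonglongrightarrow> 0"
  using tendsto_diff[OF tendsto_add[OF ftrans_tight_sequence_diff_tendsto_0[OF \<nu> X] conv[of \<xi>]]
      ftrans_tight_sequence_diff_tendsto_0[OF \<kappa> X]]
  by simp

section \<open>Mass bounds and tightness over compact parameter sets\<close>

text \<open>The total mass is the integral of the constant 1, hence continuous in the
  parameter.\<close>

lemma compactin_mass_bounded:
  assumes mu: "weakly_continuous_family X mu" and K: "compactin X K"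
  obtains m where "\<And>t. t \<in> K \<Longrightarrow> measure (mu t) UNIV \<le> m"
proof -
  have "bdd_cont (\<lambda>x::'b. 1)" by (auto simp: bdd_cont_def)
  then have "continuous_map X euclidean (\<lambda>t. LINT x|mu t. (1::complex))"
    using mu unfolding weakly_continuous_family_def by blast
  then have "bounded ((\<lambda>t. LINT x|mu t. (1::complex)) ` K)"
    using image_compactin[OF K] by (intro compact_imp_bounded) (simp flip: compactin_euclidean_iff)
  then obtain m where m: "\<And>t. t \<in> K \<Longrightarrow> norm (LINT x|mu t. (1::complex)) \<le> m"
    unfolding bounded_iff by blast
  show thesis
  proof (rule that)
    fix t assume t: "t \<in> K"
    then have "finite_borel_measure (mu t)"
      using mu compactin_subset_topspace[OF K] unfolding weakly_continuous_family_def by blast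
    then show "measure (mu t) UNIV \<le> m"
      using m[OF t] by (simp add: finite_borel_measureD)
  qed
qed

text \<open>Dini's argument: the cutoffs \<open>h k\<close> decrease to 0 pointwise, so the open
  sets \<open>U k\<close> on which their integrals are below \<open>e\<close> cover
  \<open>K\<close>. A finite subcover and monotonicity in \<open>k\<close> yield one radius for all
  parameters.\<close>

lemma compactin_uniformly_tight:
  fixes mu :: "'a \<Rightarrow> 'b::euclidean_space measure"
  assumes mu: "weakly_continuous_family X mu" and K: "compactin X K" and e: "0 < e"
  obtains R where "\<And>t. t \<in> K \<Longrightarrow> measure (mu t) {x. R < norm x} < e"
proof -
  have fin: "finite_borel_measure (mu t)" if "t \<in> topspace X" for t
    using mu that unfolding weakly_continuous_family_def by blast
  \<comment> \<open>A continuous stand-in for a tail indicator: 0 on the ball of radius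
    \<open>k\<close>, 1 beyond radius \<open>k + 1\<close>.\<close>
  define h where "h = (\<lambda>k (x::'b). min 1 (max 0 (norm x - real k)))"
  have h: "0 \<le> h k x" "h k x \<le> 1" for k x by (auto simp: h_def)
  have h_cont: "continuous_on UNIV (h k)" for k unfolding h_def by (intro continuous_intros)
  have h_int: "integrable (mu t) (h k)" if "t \<in> topspace X" for t k
    using h by (intro integrable_bounded_continuous[OF fin[OF that] h_cont, of _ 1]) auto
  have h_lim: "(\<lambda>k. h k x) \<longlonglongrightarrow> 0" for x
  proof (rule tendsto_eventually)
    obtain N where "norm x \<le> real N" using real_arch_simple by blast
    then show "\<forall>\<^sub>F k in sequentially. h k x = 0"
      by (intro eventually_sequentiallyI[of N]) (auto simp: h_def)
  qed
  \<comment> \<open>Weak continuity is formulated with complex test functions, hence the embedding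
    of \<open>h k\<close> and the half-plane \<open>Re z < e\<close>.\<close>
  define U where "U = (\<lambda>k. {t \<in> topspace X. (LINT x|mu t. complex_of_real (h k x)) \<in> {z. Re z < e}})"
  have U_iff: "t \<in> U k \<longleftrightarrow> integral\<^sup>L (mu t) (h k) < e" if "t \<in> topspace X" for t k
    using that by (simp add: U_def)
  have U_open: "openin X (U k)" for k
    unfolding U_def
  proof (rule openin_continuous_map_preimage)
    have "continuous_on UNIV (\<lambda>x. complex_of_real (h k x))" by (intro continuous_intros h_cont)
    moreover have "bounded (range (\<lambda>x. complex_of_real (h k x)))"
      using h by (auto simp: bounded_iff intro!: exI[of _ 1])
    ultimately show "continuous_map X euclidean (\<lambda>t. LINT x|mu t. complex_of_real (h k x))"
      using mu unfolding weakly_continuous_family_def bdd_cont_def by blast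
  qed (simp add: open_halfspace_Re_lt)
  have "K \<subseteq> \<Union> (range U)"
  proof
    fix t assume "t \<in> K"
    then have t: "t \<in> topspace X" using compactin_subset_topspace[OF K] by blast
    interpret finite_measure "mu t" by (rule finite_borel_measureD(3)[OF fin[OF t]])
    have "(\<lambda>k. integral\<^sup>L (mu t) (h k)) \<longlonglongrightarrow> (LINT x|mu t. 0)"
      by (rule integral_dominated_convergence[where w = "\<lambda>_. 1"])
         (use h h_lim h_int[OF t] in auto)
    then have "\<forall>\<^sub>F k in sequentially. integral\<^sup>L (mu t) (h k) < e"
      using e by (intro order_tendstoD(2)) auto
    then obtain k where "integral\<^sup>L (mu t) (h k) < e" using eventually_happens' by force
    then show "t \<in> \<Union> (range U)" using U_iff[OF t] by blast
  qed
  then obtain \<F> where "finite \<F>" "\<F> \<subseteq> range U" "K \<subseteq> \<Union> \<F>"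
    using compactinD[OF K, of "range U"] U_open by blast
  then obtain N where N: "finite N" "K \<subseteq> \<Union> (U ` N)"
    by (metis finite_subset_image)
  show thesis
  proof (rule that)
    fix t assume tK: "t \<in> K"
    then have t: "t \<in> topspace X" using compactin_subset_topspace[OF K] by blast
    interpret finite_measure "mu t" by (rule finite_borel_measureD(3)[OF fin[OF t]])
    \<comment> \<open>The largest index of the subcover fits every \<open>k\<close> in
      \<open>N\<close>: beyond radius \<open>?l + 1\<close> each such \<open>h k\<close> equals 1.
      The point \<open>t\<close> guarantees that \<open>N\<close> is nonempty.\<close>
    let ?l = "Max N"
    obtain k where k: "k \<in> N" "t \<in> U k" using N tK by blast
    have sets: "{x. real ?l + 1 < norm x} \<in> sets (mu t)"
      using finite_borel_measureD(1)[OF fin[OF t]] by simp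
    have "measure (mu t) {x. real ?l + 1 < norm x} = (LINT x|mu t. indicator {x. real ?l + 1 < norm x} x)"
      using finite_borel_measureD(2)[OF fin[OF t]] by simp
    also have "\<dots> \<le> integral\<^sup>L (mu t) (h k)"
    proof (rule integral_mono)
      show "indicator {x. real ?l + 1 < norm x} x \<le> h k x" for x :: 'b
        using Max_ge[OF N(1) k(1)] by (auto simp: indicator_def h_def)
    qed (use h_int[OF t] sets in \<open>auto intro!: integrable_real_indicator simp: emeasure_eq_measure\<close>)
    also have "\<dots> < e" using k(2) U_iff[OF t] by blast
    finally show "measure (mu t) {x. real ?l + 1 < norm x} < e" .
  qed
qed

lemma tight_sequence_compactin:
  assumes mu: "weakly_continuous_family X mu" and K: "compactin X K" and t: "\<And>n. t n \<in> K"
  shows "tight_sequence (\<lambda>n. mu (t n))"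
  unfolding tight_sequence_def
proof (intro conjI allI impI)
  show "finite_borel_measure (mu (t n))" for n
    using mu compactin_subset_topspace[OF K] t unfolding weakly_continuous_family_def by blast
  show "\<exists>m. \<forall>n. measure (mu (t n)) UNIV \<le> m"
    using compactin_mass_bounded[OF mu K] t by meson
  show "\<exists>R. \<forall>\<^sub>F n in sequentially. measure (mu (t n)) {x. R < norm x} < e" if "0 < e" for e
    using compactin_uniformly_tight[OF mu K that] t by (meson always_eventually)
qed

section \<open>Passage from uniform convergence to sequences\<close>

text \<open>\<open>K\<close> is an arbitrary set, so this applies to parameters as well as to pairs
  of a frequency and a parameter.\<close>

lemma not_eventually_ball_sequentially:
  assumes "\<not> (\<forall>\<^sub>F n in sequentially. \<forall>t\<in>K. P n t)"
  obtains r :: "nat \<Rightarrow> nat" and t where "strict_mono r" "\<And>n. t n \<in> K" "\<And>n. \<not> P (r n) (t n)"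
  using not_eventually_sequentiallyD[OF assms] by metis

text \<open>Pointwise refers to the frequency alone; uniformity over compact parameter sets is kept.
  Both equivalences pass through this condition.\<close>

definition ftrans_conv_pointwise ::
    "'a topology \<Rightarrow> (nat \<Rightarrow> 'a \<Rightarrow> 'b::euclidean_space measure) \<Rightarrow> ('a \<Rightarrow> 'b measure) \<Rightarrow> bool" where
  "ftrans_conv_pointwise X mun mu \<longleftrightarrow>
     (\<forall>\<xi> K. compactin X K \<longrightarrow> (\<forall>e>0. \<forall>\<^sub>F n in sequentially. \<forall>t\<in>K.
        norm (ftrans (mun n t) \<xi> - ftrans (mu t) \<xi>) < e))"

text \<open>Uniformity over \<open>K\<close> allows the parameter to move with \<open>n\<close>. The
  measures \<open>mu (t n)\<close> are tight because \<open>K\<close> is compact, and tightness is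
  then transferred to \<open>mun (r n) (t n)\<close>.\<close>

lemma ftrans_conv_pointwise_sequence:
  assumes mu: "weakly_continuous_family X mu" and mun: "\<And>n. weakly_continuous_family X (mun n)"
    and conv: "ftrans_conv_pointwise X mun mu"
    and K: "compactin X K" and r: "strict_mono r" and t: "\<And>n. t n \<in> K"
  shows "(\<lambda>n. ftrans (mun (r n) (t n)) \<xi> - ftrans (mu (t n)) \<xi>) \<longlonglongrightarrow> 0" (is ?lim)
    and "tight_sequence (\<lambda>n. mun (r n) (t n))"
proof -
  have lim: "(\<lambda>n. ftrans (mun (r n) (t n)) \<xi> - ftrans (mu (t n)) \<xi>) \<longlonglongrightarrow> 0" for \<xi>
  proof (rule tendstoI)
    fix e :: real assume "0 < e"
    then have "\<forall>\<^sub>F n in sequentially. \<forall>t\<in>K. norm (ftrans (mun n t) \<xi> - ftrans (mu t) \<xi>) < e"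
      using conv K unfolding ftrans_conv_pointwise_def by blast
    then have "\<forall>\<^sub>F n in sequentially. \<forall>t\<in>K. norm (ftrans (mun (r n) t) \<xi> - ftrans (mu t) \<xi>) < e"
      by (rule eventually_subseq[OF r])
    then show "\<forall>\<^sub>F n in sequentially. dist (ftrans (mun (r n) (t n)) \<xi> - ftrans (mu (t n)) \<xi>) 0 < e"
      by (rule eventually_mono) (use t in auto)
  qed
  then show ?lim .
  have "finite_borel_measure (mun (r n) (t n))" for n
    using mun compactin_subset_topspace[OF K] t unfolding weakly_continuous_family_def by blast
  then show "tight_sequence (\<lambda>n. mun (r n) (t n))"
    by (rule tight_sequence_transfer[OF _ tight_sequence_compactin[OF mu K t] lim])
qed

section \<open>Equivalence of the three modes of convergence\<close>

lemma luw_conv_imp_ftrans_conv_pointwise: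
  assumes "luw_conv X mun mu"
  shows "ftrans_conv_pointwise X mun mu"
proof -
  have "bdd_cont (\<lambda>x. cis (\<xi> \<bullet> x))" for \<xi> :: 'b
    by (auto simp: bdd_cont_def bounded_iff intro!: continuous_on_cis continuous_intros exI[of _ 1])
  then show ?thesis
    using assms unfolding luw_conv_def ftrans_conv_pointwise_def ftrans_def by blast
qed

lemma ftrans_conv_pointwise_imp_luw_conv:
  assumes mu: "weakly_continuous_family X mu" and mun: "\<And>n. weakly_continuous_family X (mun n)"
    and conv: "ftrans_conv_pointwise X mun mu"
  shows "luw_conv X mun mu"
  unfolding luw_conv_def
proof (intro allI impI, elim conjE)
  fix K and f :: "'b \<Rightarrow> complex" and e :: real
  assume K: "compactin X K" and "bdd_cont f" and e: "0 < e"
  then obtain B where f: "continuous_on UNIV f" and B: "\<And>x. norm (f x) \<le> B"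
    by (auto simp: bdd_cont_def bounded_iff)
  show "\<forall>\<^sub>F n in sequentially. \<forall>t\<in>K. norm (integral\<^sup>L (mun n t) f - integral\<^sup>L (mu t) f) < e"
  proof (rule ccontr)
    assume "\<not> ?thesis"
    then obtain r :: "nat \<Rightarrow> nat" and t where r: "strict_mono r" and t: "\<And>n. t n \<in> K"
      and neg: "\<And>n. \<not> norm (integral\<^sup>L (mun (r n) (t n)) f - integral\<^sup>L (mu (t n)) f) < e"
      by (rule not_eventually_ball_sequentially) (rule that)
    note seq = ftrans_conv_pointwise_sequence[OF mu mun conv K r t]
    have "(\<lambda>n. integral\<^sup>L (mun (r n) (t n)) f - integral\<^sup>L (mu (t n)) f) \<longlonglongrightarrow> 0"
      by (rule integral_diff_tendsto_0[OF seq(2) tight_sequence_compactin[OF mu K t] seq(1) f B])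
    from tendstoD[OF this e] show False
      using neg by simp
  qed
qed

lemma ftrans_conv_pointwise_imp_locally_uniform:
  assumes mu: "weakly_continuous_family X mu" and mun: "\<And>n. weakly_continuous_family X (mun n)"
    and conv: "ftrans_conv_pointwise X mun mu"
    and C: "compactin (prod_topology euclidean X) C" and e: "0 < e"
  shows "\<forall>\<^sub>F n in sequentially. \<forall>(\<xi>, t)\<in>C. norm (ftrans (mun n t) \<xi> - ftrans (mu t) \<xi>) < e"
proof (rule ccontr)
  assume "\<not> ?thesis"
  then obtain r :: "nat \<Rightarrow> nat" and p where r: "strict_mono r" and p: "\<And>n. p n \<in> C"
    and neg: "\<And>n. \<not> (case p n of (\<xi>, t) \<Rightarrow> norm (ftrans (mun (r n) t) \<xi> - ftrans (mu t) \<xi>) < e)"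
    by (rule not_eventually_ball_sequentially) (rule that)
  \<comment> \<open>Only the frequencies are made to converge along a subsequence. On the parameter
    side, the compact projection of \<open>C\<close> supplies tightness and the compact set on which
    \<open>conv\<close> is applied.\<close>
  have "compact (fst ` C)"
    using image_compactin[OF C continuous_map_fst] by simp
  moreover have "\<forall>n. fst (p n) \<in> fst ` C" using p by blast
  ultimately obtain \<xi> s where s: "strict_mono s" and \<xi>: "((\<lambda>n. fst (p n)) \<circ> s) \<longlonglongrightarrow> \<xi>"
    unfolding compact_def by metis
  have K: "compactin X (snd ` C)"
    using image_compactin[OF C continuous_map_snd] .
  have t: "snd (p (s n)) \<in> snd ` C" for n using p by blast
  note seq = ftrans_conv_pointwise_sequence[OF mu mun conv K strict_mono_o[OF r s] t]
  have "(\<lambda>n. ftrans (mun ((r \<circ> s) n) (snd (p (s n)))) (fst (p (s n))) -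
      ftrans (mu (snd (p (s n)))) (fst (p (s n)))) \<longlonglongrightarrow> 0"
    using ftrans_diff_tendsto_0[OF seq(2) tight_sequence_compactin[OF mu K t] seq(1) \<xi>]
    by (simp add: o_def)
  from tendstoD[OF this e] show False
    using neg by (simp add: split_beta)
qed

lemma ftrans_locally_uniform_imp_pointwise:
  fixes mu :: "'a \<Rightarrow> 'b::euclidean_space measure"
  assumes conv: "\<And>C e. compactin (prod_topology euclidean X) C \<Longrightarrow> 0 < e \<Longrightarrow>
      \<forall>\<^sub>F n in sequentially. \<forall>(\<xi>, t)\<in>C. norm (ftrans (mun n t) \<xi> - ftrans (mu t) \<xi>) < e"
  shows "ftrans_conv_pointwise X mun mu"
  unfolding ftrans_conv_pointwise_def
proof (intro allI impI)
  fix \<xi> :: 'b and K and e :: real assume "compactin X K" "0 < e"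
  \<comment> \<open>A single frequency times a compact parameter set is compact in the
    product.\<close>
  then have "\<forall>\<^sub>F n in sequentially. \<forall>(\<eta>, t)\<in>{\<xi>} \<times> K. norm (ftrans (mun n t) \<eta> - ftrans (mu t) \<eta>) < e"
    by (intro conv) (auto simp: compactin_Times)
  then show "\<forall>\<^sub>F n in sequentially. \<forall>t\<in>K. norm (ftrans (mun n t) \<xi> - ftrans (mu t) \<xi>) < e"
    by (rule eventually_mono) auto
qed

theorem theorem2p6:
  fixes X :: "'a topology"
    and mu :: "'a \<Rightarrow> 'b::euclidean_space measure"
    and mun :: "nat \<Rightarrow> 'a \<Rightarrow> 'b measure"
  assumes "second_countable X" and "locally_compact_space X"
    and "weakly_continuous_family X mu"
    and "\<And>n. weakly_continuous_family X (mun n)"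
  shows "(luw_conv X mun mu
            \<longleftrightarrow> (\<forall>C. compactin (prod_topology euclidean X) C \<longrightarrow>
                  (\<forall>e>0. \<forall>\<^sub>F n in sequentially. \<forall>(\<xi>, t)\<in>C.
                    norm (ftrans (mun n t) \<xi> - ftrans (mu t) \<xi>) < e)))
       \<and> (luw_conv X mun mu
            \<longleftrightarrow> (\<forall>\<xi> K. compactin X K \<longrightarrow>
                  (\<forall>e>0. \<forall>\<^sub>F n in sequentially. \<forall>t\<in>K.
                    norm (ftrans (mun n t) \<xi> - ftrans (mu t) \<xi>) < e)))"
proof -
  have "luw_conv X mun mu \<longleftrightarrow> ftrans_conv_pointwise X mun mu"
    using luw_conv_imp_ftrans_conv_pointwise ftrans_conv_pointwise_imp_luw_conv[OF assms(3,4)] by (rule iffI)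
  moreover have "ftrans_conv_pointwise X mun mu \<longleftrightarrow> (\<forall>C. compactin (prod_topology euclidean X) C \<longrightarrow>
      (\<forall>e>0. \<forall>\<^sub>F n in sequentially. \<forall>(\<xi>, t)\<in>C. norm (ftrans (mun n t) \<xi> - ftrans (mu t) \<xi>) < e))"
  proof (intro iffI allI impI)
    show "\<forall>\<^sub>F n in sequentially. \<forall>(\<xi>, t)\<in>C. norm (ftrans (mun n t) \<xi> - ftrans (mu t) \<xi>) < e"
      if "ftrans_conv_pointwise X mun mu" "compactin (prod_topology euclidean X) C" "0 < e" for C e
      by (rule ftrans_conv_pointwise_imp_locally_uniform[OF assms(3,4) that])
  qed (rule ftrans_locally_uniform_imp_pointwise, blast)
  ultimately show ?thesis
    unfolding ftrans_conv_pointwise_def by blast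
qed

end
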